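(* Let $t$ be an indeterminate and let the rational functions $\tau_n(t)$ be defined by $\tau_0(t)=1+t$, $\tau_{2n}(t)=\frac{1+t^{n+1}}{1+t^n}$ for $n>0$, and $\tau_{2n+1}(t)=\frac{t(1+t^n)}{1+t^{n+1}}$ for $n\ge 0$. Define polynomials $L_n(x,t)$ by $L_0(x,t)=1$, $L_1(x,t)=x$ and $L_n(x,t)=xL_{n-1}(x,t)-\tau_{n-2}(t)L_{n-2}(x,t)$ for $n\ge 2$, and set $S_n(x,t)=\frac{L_{2n+1}(\sqrt{x},t)}{\sqrt{x}}$ (a polynomial of degree $n$ in $x$). For $0\le k\le n$ let $$E_{n,k}(t)=\frac{\sum_{j=0}^{n-k}\binom{n}{k+j}\binom{n+1}{j}\bigl(t^j+t^{n+1-j}\bigr)}{1+t^{k+1}},$$ and $E_{n,k}(t)=0$ for $k>n$. Then for every $n\ge 0$, $$\sum_{k=0}^n E_{n,k}(t)\,S_k(x,t)=x^n,$$ i.e. the $E_{n,k}(t)$ are the (uniquely determined) coefficients expressing $x^n$ in the basis $(S_k(x,t))_{k\ge0}$. *)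

theory Defs
  imports "HOL-Computational_Algebra.Computational_Algebra"
begin

text \<open>
  The field of rational functions in \<open>t\<close> over a field \<open>'a\<close> of characteristic 0 is
  \<open>'a poly fract\<close>; polynomials in \<open>x\<close> over it have type \<open>'a poly fract poly\<close>.
\<close>

definition t :: "'a::field_char_0 poly fract" where
  "t = to_fract [:0, 1:]"

definition tau :: "nat \<Rightarrow> 'a::field_char_0 poly fract" where
  "tau m =
    (if m = 0 then 1 + t
     else if even m then (1 + t ^ (m div 2 + 1)) / (1 + t ^ (m div 2))
     else t * (1 + t ^ (m div 2)) / (1 + t ^ (m div 2 + 1)))"

lemma tau_0: "tau 0 = 1 + t"
  by (simp add: tau_def)

lemma tau_even: "n > 0 \<Longrightarrow> tau (2 * n) = (1 + t ^ (n + 1)) / (1 + t ^ n)"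
  by (simp add: tau_def)

lemma tau_odd: "tau (2 * n + 1) = t * (1 + t ^ n) / (1 + t ^ (n + 1))"
  by (simp add: tau_def)

lemma one_plus_t_power_nonzero: "1 + t ^ n \<noteq> (0 :: 'a::field_char_0 poly fract)"
proof -
  have "t ^ n = to_fract ([:0, 1:] ^ n :: 'a poly)"
    unfolding t_def by (induction n) (simp_all flip: to_fract_mult)
  then have eq: "1 + t ^ n = to_fract (1 + [:0, 1:] ^ n :: 'a poly)"
    by (simp flip: to_fract_1 to_fract_add)
  have "poly (1 + [:0, 1:] ^ n :: 'a poly) 1 \<noteq> 0"
    by simp
  then have "(1 + [:0, 1:] ^ n :: 'a poly) \<noteq> 0"
    by (metis poly_0)
  then show ?thesis
    unfolding eq by (simp only: to_fract_eq_0_iff not_False_eq_True)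
qed

fun L :: "nat \<Rightarrow> 'a::field_char_0 poly fract poly" where
  "L 0 = 1"
| "L (Suc 0) = [:0, 1:]"
| "L (Suc (Suc n)) = [:0, 1:] * L (Suc n) - smult (tau n) (L n)"

text \<open>
  With \<open>y\<close> for the square root of \<open>x\<close>, the equation \<open>S_n(x) = L_{2n+1}(sqrt x) / sqrt x\<close>
  reads \<open>y * S_n(y^2) = L_{2n+1}(y)\<close>. It has exactly one polynomial solution, see
  \<open>S_ex1\<close> below.
\<close>

definition S :: "nat \<Rightarrow> 'a::field_char_0 poly fract poly" where
  "S n = (THE p. [:0, 1:] * pcompose p ([:0, 1:] ^ 2) = L (2 * n + 1))"

lemma L_parity:
  "(\<exists>p. L (2 * n) = pcompose p ([:0, 1:] ^ 2 :: 'a::field_char_0 poly fract poly)) \<and>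
   (\<exists>q :: 'a poly fract poly. L (2 * n + 1) = [:0, 1:] * pcompose q ([:0, 1:] ^ 2))"
proof (induction n)
  case 0
  have "L (2 * 0) = pcompose 1 ([:0, 1:] ^ 2 :: 'a poly fract poly)"
    and "L (2 * 0 + 1) = [:0, 1:] * pcompose 1 ([:0, 1:] ^ 2 :: 'a poly fract poly)"
    by (simp_all add: pcompose_1)
  then show ?case by blast
next
  case (Suc n)
  then obtain p q :: "'a poly fract poly" where p: "L (2 * n) = pcompose p ([:0, 1:] ^ 2)"
    and q: "L (2 * n + 1) = [:0, 1:] * pcompose q ([:0, 1:] ^ 2)"
    by blast
  let ?p = "[:0, 1:] * q - smult (tau (2 * n)) p"
  have X: "pcompose [:0, 1:] ([:0, 1:] ^ 2) = ([:0, 1:] ^ 2 :: 'a poly fract poly)"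
    by (simp add: pcompose_pCons)
  have 1: "L (2 * Suc n) = pcompose ?p ([:0, 1:] ^ 2)"
  proof -
    have "L (2 * Suc n) = [:0, 1:] * L (2 * n + 1) - smult (tau (2 * n)) (L (2 * n))"
      by simp
    also have "\<dots> = [:0, 1:] ^ 2 * pcompose q ([:0, 1:] ^ 2)
        - smult (tau (2 * n)) (pcompose p ([:0, 1:] ^ 2))"
      unfolding p q power2_eq_square by (simp only: mult.assoc)
    also have "\<dots> = pcompose ?p ([:0, 1:] ^ 2)"
      by (simp only: pcompose_diff pcompose_mult pcompose_smult X)
    finally show ?thesis .
  qed
  have "L (2 * Suc n + 1) = [:0, 1:] * L (2 * Suc n) - smult (tau (2 * n + 1)) (L (2 * n + 1))"
    by simp
  also have "\<dots> = [:0, 1:] * pcompose (?p - smult (tau (2 * n + 1)) q) ([:0, 1:] ^ 2)"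
    unfolding 1 q
    by (simp only: pcompose_diff pcompose_smult right_diff_distrib mult_smult_right)
  finally show ?case
    using 1 by blast
qed

lemma S_ex1: "\<exists>!p. [:0, 1:] * pcompose p ([:0, 1:] ^ 2) = L (2 * n + 1)"
proof (rule ex_ex1I)
  show "\<exists>p. [:0, 1:] * pcompose p ([:0, 1:] ^ 2) = L (2 * n + 1)"
    using L_parity[of n] by metis
next
  fix p q :: "'a poly fract poly"
  assume "[:0, 1:] * pcompose p ([:0, 1:] ^ 2) = L (2 * n + 1)"
    and "[:0, 1:] * pcompose q ([:0, 1:] ^ 2) = L (2 * n + 1)"
  then have "[:0, 1:] * pcompose p ([:0, 1:] ^ 2) = [:0, 1:] * pcompose q ([:0, 1:] ^ 2)"
    by simp
  then have "pcompose p ([:0, 1:] ^ 2) = pcompose q ([:0, 1:] ^ 2)"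
    by (subst (asm) mult_cancel_left) simp
  then have "pcompose (p - q) ([:0, 1:] ^ 2) = 0"
    by (simp only: pcompose_diff diff_self)
  moreover have "degree ([:0, 1:] ^ 2 :: 'a poly fract poly) > 0"
    by (simp add: degree_power_eq)
  ultimately have "p - q = 0"
    by (rule pcompose_eq_0)
  then show "p = q" by simp
qed

lemma S_eq: "[:0, 1:] * pcompose (S n) ([:0, 1:] ^ 2) = L (2 * n + 1)"
  unfolding S_def by (rule theI'[OF S_ex1])

definition E :: "nat \<Rightarrow> nat \<Rightarrow> 'a::field_char_0 poly fract" where
  "E n k =
    (if k \<le> n then
       (\<Sum>j=0..n - k. of_nat (n choose (k + j)) * of_nat ((n + 1) choose j)
          * (t ^ j + t ^ (n + 1 - j))) / (1 + t ^ (k + 1))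
     else 0)"

definition is_basis_sequence :: "(nat \<Rightarrow> 'b::field poly) \<Rightarrow> bool" where
  "is_basis_sequence B \<longleftrightarrow>
     inj B \<and> \<not> module.dependent smult (range B) \<and> module.span smult (range B) = UNIV"

end

theory Submission
  imports Defs
begin

text \<open>
  Unlike the \<open>S_k\<close>, the even-indexed polynomials \<open>R_k(x) = L_{2k}(sqrt x)\<close> satisfy a three-term
  recurrence with constant coefficients, \<open>x R_k = R_{k+1} + (1 + t) R_k + t R_{k-1}\<close> for \<open>k > 1\<close>,
  with \<open>2 t\<close> in place of \<open>t\<close> for \<open>k = 1\<close>. Multiplication by \<open>x\<close> thus acts like multiplication by
  \<open>(1 + z)(1 + t/z) = z + (1 + t) + t/z\<close>, and \<open>x^n\<close> is the sum of \<open>q_{n,k} R_k\<close>, where \<open>q_{n,k}\<close> is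
  the coefficient of \<open>z^k\<close> in \<open>((1 + z)(1 + t/z))^n\<close>. Substituting
  \<open>R_k = S_k + tau_{2k-1} S_{k-1}\<close> gives \<open>E_{n,k} = q_{n,k} + tau_{2k+1} q_{n,k+1}\<close>.
\<close>

section \<open>Laurent coefficients of the powers of (1 + z)(1 + u/z)\<close>

text \<open>The coefficient of \<open>z^k\<close> in \<open>((1 + z)(1 + u/z))^n\<close>.\<close>

definition laurent_coeff :: "'b::comm_ring_1 \<Rightarrow> nat \<Rightarrow> nat \<Rightarrow> 'b" where
  "laurent_coeff u n k = (\<Sum>j\<le>n. of_nat (n choose j) * of_nat (n choose (j + k)) * u ^ j)"

lemma laurent_coeff_eq_0: "n < k \<Longrightarrow> laurent_coeff u n k = 0"
  by (simp add: laurent_coeff_def binomial_eq_0)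

text \<open>Only the term j = 0 is split off: the added top term vanishes because
  \<open>n choose Suc n\<close> is 0. In this form the sum matches the terms that Pascal's rule
  produces below.\<close>

lemma laurent_coeff_shift:
  "laurent_coeff u n k = of_nat (n choose k)
    + (\<Sum>j\<le>n. of_nat (n choose Suc j) * of_nat (n choose (Suc j + k)) * u ^ Suc j)"
proof -
  have "laurent_coeff u n k
      = (\<Sum>j\<le>Suc n. of_nat (n choose j) * of_nat (n choose (j + k)) * u ^ j)"
    by (simp add: laurent_coeff_def binomial_eq_0)
  also have "\<dots> = of_nat (n choose k)
      + (\<Sum>j\<le>n. of_nat (n choose Suc j) * of_nat (n choose (Suc j + k)) * u ^ Suc j)"
    by (subst sum.atMost_Suc_shift) simp
  finally show ?thesis .
qed

text \<open>Multiplication by z + (1 + u) + u/z, read off at z^(k+1). Pascal's rule on both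
  binomials gives four products: one for z, two for 1 + u, one for u/z.\<close>

lemma laurent_coeff_Suc_Suc:
  fixes u :: "'b::comm_ring_1"
  shows
  "laurent_coeff u (Suc n) (Suc k) = laurent_coeff u n k
    + (1 + u) * laurent_coeff u n (Suc k) + u * laurent_coeff u n (Suc (Suc k))"
proof -
  let ?b = "\<lambda>j. of_nat (n choose j) :: 'b"
  have "laurent_coeff u (Suc n) (Suc k) = of_nat (Suc n choose Suc k)
      + (\<Sum>j\<le>n. of_nat (Suc n choose Suc j) * of_nat (Suc n choose (Suc j + Suc k)) * u ^ Suc j)"
    unfolding laurent_coeff_def by (subst sum.atMost_Suc_shift) simp
  also have "\<dots> = ?b k + ?b (Suc k)
      + (\<Sum>j\<le>n. ?b (Suc j) * ?b (Suc j + k) * u ^ Suc j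
          + ?b (Suc j) * ?b (Suc j + Suc k) * u ^ Suc j
          + u * (?b j * ?b (j + Suc k) * u ^ j) + u * (?b j * ?b (j + Suc (Suc k)) * u ^ j))"
    by (simp add: algebra_simps)
  also have "\<dots> = (?b k + (\<Sum>j\<le>n. ?b (Suc j) * ?b (Suc j + k) * u ^ Suc j))
      + (?b (Suc k) + (\<Sum>j\<le>n. ?b (Suc j) * ?b (Suc j + Suc k) * u ^ Suc j))
      + u * laurent_coeff u n (Suc k) + u * laurent_coeff u n (Suc (Suc k))"
    by (simp only: sum.distrib sum_distrib_left[symmetric] laurent_coeff_def ac_simps)
  also have "\<dots> = laurent_coeff u n k
      + (1 + u) * laurent_coeff u n (Suc k) + u * laurent_coeff u n (Suc (Suc k))"
    by (simp only: laurent_coeff_shift[symmetric]) (simp add: algebra_simps)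
  finally show ?thesis .
qed

text \<open>The symmetry z -> u/z makes the coefficient of z^(-1) equal to u times that of z. Both
  neighbours of z^0 therefore contribute the same amount, whence the factor 2.\<close>

lemma laurent_coeff_Suc_0:
  fixes u :: "'b::comm_ring_1"
  shows
  "laurent_coeff u (Suc n) 0 = (1 + u) * laurent_coeff u n 0 + 2 * u * laurent_coeff u n 1"
proof -
  let ?b = "\<lambda>j. of_nat (n choose j) :: 'b"
  have "laurent_coeff u (Suc n) 0 = 1
      + (\<Sum>j\<le>n. of_nat (Suc n choose Suc j) * of_nat (Suc n choose (Suc j + 0)) * u ^ Suc j)"
    unfolding laurent_coeff_def by (subst sum.atMost_Suc_shift) simp
  also have "\<dots> = ?b 0
      + (\<Sum>j\<le>n. ?b (Suc j) * ?b (Suc j + 0) * u ^ Suc j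
          + 2 * u * (?b j * ?b (j + 1) * u ^ j) + u * (?b j * ?b (j + 0) * u ^ j))"
    by (simp add: algebra_simps)
  also have "\<dots> = (?b 0 + (\<Sum>j\<le>n. ?b (Suc j) * ?b (Suc j + 0) * u ^ Suc j))
      + 2 * u * laurent_coeff u n 1 + u * laurent_coeff u n 0"
    by (simp only: sum.distrib sum_distrib_left[symmetric] laurent_coeff_def ac_simps)
  also have "\<dots> = (1 + u) * laurent_coeff u n 0 + 2 * u * laurent_coeff u n 1"
    by (simp only: laurent_coeff_shift[symmetric]) (simp add: algebra_simps)
  finally show ?thesis .
qed

section \<open>The numerator of \<open>E\<close> in terms of Laurent coefficients\<close>

lemma sum_binomial_shifted:
  assumes "k \<le> n"
  shows "(\<Sum>j=0..n - k. of_nat (n choose (k + j)) * of_nat ((n + 1) choose j) * u ^ j)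
    = laurent_coeff u n k + u * laurent_coeff u n (Suc k)"
proof -
  let ?b = "\<lambda>j. of_nat (n choose j) :: 'b::comm_ring_1"
  have "(\<Sum>j=0..n - k. ?b (k + j) * of_nat ((n + 1) choose j) * u ^ j)
      = (\<Sum>j\<le>Suc n. ?b (k + j) * of_nat ((n + 1) choose j) * u ^ j)"
    using assms by (intro sum.mono_neutral_left) (auto simp: binomial_eq_0)
  also have "\<dots> = ?b k + (\<Sum>j\<le>n. ?b (Suc j) * ?b (Suc j + k) * u ^ Suc j
      + u * (?b j * ?b (j + Suc k) * u ^ j))"
    by (subst sum.atMost_Suc_shift) (simp add: algebra_simps)
  also have "\<dots> = laurent_coeff u n k + u * laurent_coeff u n (Suc k)"
    by (subst laurent_coeff_shift)
      (simp only: sum.distrib sum_distrib_left[symmetric] laurent_coeff_def ac_simps)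
  finally show ?thesis .
qed

text \<open>Put j = n - k - i. Binomial symmetry turns the two factors into
  \<open>n choose i\<close> and \<open>Suc n choose Suc (i + k)\<close>, and the exponent into k + 1
  + i. Pascal's rule then splits the second factor.\<close>

lemma sum_binomial_reflected:
  assumes "k \<le> n"
  shows "(\<Sum>j=0..n - k. of_nat (n choose (k + j)) * of_nat ((n + 1) choose j) * u ^ (n + 1 - j))
    = u ^ Suc k * (laurent_coeff u n k + laurent_coeff u n (Suc k))"
proof -
  let ?b = "\<lambda>j. of_nat (n choose j) :: 'b::comm_ring_1"
  have eq: "?b (k + (n - k - i)) * of_nat ((n + 1) choose (n - k - i)) * u ^ (n + 1 - (n - k - i))
      = u ^ Suc k * (?b i * ?b (i + k) * u ^ i + ?b i * ?b (i + Suc k) * u ^ i)"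
    if "i \<le> n - k" for i
  proof -
    have le: "i + k \<le> n" using that assms by linarith
    have "n choose (k + (n - k - i)) = n choose i"
      using le binomial_symmetric[of i n] by (simp add: algebra_simps)
    moreover have "(n + 1) choose (n - k - i) = Suc n choose Suc (i + k)"
      using le binomial_symmetric[of "Suc (i + k)" "Suc n"] by (simp add: add.commute)
    moreover have "n + 1 - (n - k - i) = Suc k + i"
      using le by simp
    ultimately show ?thesis
      by (simp add: algebra_simps power_add)
  qed
  have "(\<Sum>j=0..n - k. ?b (k + j) * of_nat ((n + 1) choose j) * u ^ (n + 1 - j))
      = (\<Sum>i\<le>n - k. u ^ Suc k * (?b i * ?b (i + k) * u ^ i + ?b i * ?b (i + Suc k) * u ^ i))"
    unfolding atLeast0AtMost
    by (subst sum.nat_diff_reindex[symmetric, of _ "Suc (n - k)", unfolded lessThan_Suc_atMost])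
      (intro sum.cong, simp_all only: diff_Suc_Suc atMost_iff eq)
  also have "\<dots> = (\<Sum>i\<le>n. u ^ Suc k * (?b i * ?b (i + k) * u ^ i + ?b i * ?b (i + Suc k) * u ^ i))"
  proof (intro sum.mono_neutral_left ballI)
    fix i assume "i \<in> {..n} - {..n - k}"
    then have "n < i + k" by auto
    then show "u ^ Suc k * (?b i * ?b (i + k) * u ^ i + ?b i * ?b (i + Suc k) * u ^ i) = 0"
      by (simp add: binomial_eq_0)
  qed auto
  also have "\<dots> = u ^ Suc k * (laurent_coeff u n k + laurent_coeff u n (Suc k))"
    by (simp only: sum.distrib sum_distrib_left[symmetric] laurent_coeff_def)
  finally show ?thesis .
qed

text \<open>In the sum of the two halves the second coefficient gets the factor t + t^(k+1) = t (1 +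
  t^k), which over 1 + t^(k+1) is exactly \<open>tau (2 * k + 1)\<close>.\<close>

lemma E_eq_laurent_coeff:
  "(E n k :: 'a::field_char_0 poly fract) = laurent_coeff t n k + tau (2 * k + 1) * laurent_coeff t n (Suc k)"
proof (cases "k \<le> n")
  case True
  have "(\<Sum>j=0..n - k. of_nat (n choose (k + j)) * of_nat ((n + 1) choose j)
          * (t ^ j + t ^ (n + 1 - j)) :: 'a poly fract)
      = (1 + t ^ (k + 1)) * laurent_coeff t n k
        + t * (1 + t ^ k) * laurent_coeff t n (Suc k)"
    by (simp only: distrib_left[of "_ * _"] sum.distrib sum_binomial_shifted[OF True]
        sum_binomial_reflected[OF True]) (simp add: algebra_simps)
  then show ?thesis
    unfolding E_def tau_odd using True one_plus_t_power_nonzero[of "k + 1", where 'a = 'a]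
    by (simp add: add_divide_distrib)
qed (simp add: E_def laurent_coeff_eq_0)

section \<open>The even-indexed polynomials and their three-term recurrence\<close>

text \<open>\<open>even_part k\<close> is \<open>L_{2k}(sqrt x)\<close>.\<close>

fun even_part :: "nat \<Rightarrow> 'a::field_char_0 poly fract poly" where
  "even_part 0 = 1"
| "even_part (Suc k) = [:0, 1:] * S k - smult (tau (2 * k)) (even_part k)"

lemma L_even: "L (2 * k) = pcompose (even_part k) ([:0, 1:] ^ 2 :: 'a::field_char_0 poly fract poly)"
proof (induction k)
  case (Suc k)
  have "(L (2 * Suc k) :: 'a poly fract poly) = [:0, 1:] * L (2 * k + 1) - smult (tau (2 * k)) (L (2 * k))"
    by simp
  also have "\<dots> = [:0, 1:] ^ 2 * pcompose (S k) ([:0, 1:] ^ 2)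
      - smult (tau (2 * k)) (pcompose (even_part k) ([:0, 1:] ^ 2))"
    by (simp only: Suc S_eq[symmetric] power2_eq_square mult.assoc)
  also have "\<dots> = pcompose (even_part (Suc k)) ([:0, 1:] ^ 2)"
    by (simp add: pcompose_diff pcompose_mult pcompose_smult pcompose_pCons)
  finally show ?case .
qed (simp add: pcompose_1)

lemma S_unique: "[:0, 1:] * pcompose p ([:0, 1:] ^ 2) = L (2 * n + 1) \<Longrightarrow> S n = p"
  using S_ex1 S_eq by blast

lemma S_0: "S 0 = 1"
  by (rule S_unique) (simp add: pcompose_1)

lemma S_Suc: "S (Suc k) = even_part (Suc k) - smult (tau (2 * k + 1)) (S k)"
proof (rule S_unique)
  have "L (2 * Suc k + 1) = [:0, 1:] * L (2 * Suc k) - smult (tau (2 * k + 1)) (L (2 * k + 1))"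
    by simp
  also have "\<dots> = [:0, 1:] * pcompose (even_part (Suc k) - smult (tau (2 * k + 1)) (S k)) ([:0, 1:] ^ 2)"
    by (simp only: L_even S_eq[symmetric] pcompose_diff pcompose_smult right_diff_distrib mult_smult_right)
  finally show "[:0, 1:] * pcompose (even_part (Suc k) - smult (tau (2 * k + 1)) (S k)) ([:0, 1:] ^ 2)
      = L (2 * Suc k + 1)" ..
qed

lemma tau_odd_plus_even: "tau (2 * k + 1) + tau (2 * k + 2) = (1 + t :: 'a::field_char_0 poly fract)"
proof -
  have "(tau (2 * k + 2) :: 'a poly fract) = (1 + t ^ (k + 2)) / (1 + t ^ (k + 1))"
    using tau_even[of "k + 1"] by simp
  moreover have "(t :: 'a poly fract) * (1 + t ^ k) + (1 + t ^ (k + 2)) = (1 + t) * (1 + t ^ (k + 1))"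
    by (simp add: algebra_simps)
  ultimately show ?thesis
    by (simp only: tau_odd add_divide_distrib[symmetric] nonzero_mult_div_cancel_right
        one_plus_t_power_nonzero not_False_eq_True)
qed

text \<open>For k > 0 the two fractions cancel up to t. The exception at k = 0 arises because
  \<open>tau 0\<close> is twice the value (1 + t)/2 that the even formula would give there.\<close>

lemma tau_even_times_odd: "tau (2 * k + 1) * tau (2 * k) = (if k = 0 then 2 * t else t :: 'a::field_char_0 poly fract)"
proof (cases "k = 0")
  case True
  then show ?thesis
    using one_plus_t_power_nonzero[of 1, where 'a = 'a] by (simp add: tau_def)
next
  case False
  have cancel: "t * a / b * (b / a) = t" if "a \<noteq> 0" "b \<noteq> 0" for a b :: "'a poly fract"
    using that by simp
  have "tau (2 * k) = (1 + t ^ (k + 1) :: 'a poly fract) / (1 + t ^ k)"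
    using False by (intro tau_even) simp
  with False show ?thesis
    by (simp only: tau_odd cancel one_plus_t_power_nonzero not_False_eq_True if_False)
qed

lemma X_times_even_part_0: "[:0, 1:] * even_part 0 = even_part 1 + smult (1 + t) (even_part 0)"
  by (simp add: S_0 tau_0)

text \<open>Write the left factor as \<open>S (Suc k)\<close> plus a multiple of \<open>S k\<close>,
  then turn each x \<open>S i\<close> back into even parts. The tau values enter only through a sum
  and a product, in which the powers of t cancel.\<close>

lemma X_times_even_part_Suc:
  "[:0, 1:] * even_part (Suc k)
    = (even_part (Suc (Suc k)) :: 'a::field_char_0 poly fract poly) + smult (1 + t) (even_part (Suc k))
    + smult (if k = 0 then 2 * t else t) (even_part k)"
proof -
  have X: "[:0, 1:] * S i = (even_part (Suc i) :: 'a poly fract poly) + smult (tau (2 * i)) (even_part i)" for i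
    by simp
  have "even_part (Suc k) = (S (Suc k) :: 'a poly fract poly) + smult (tau (2 * k + 1)) (S k)"
    by (simp only: S_Suc diff_add_cancel)
  then have "[:0, 1:] * even_part (Suc k)
      = ([:0, 1:] * S (Suc k) :: 'a poly fract poly) + smult (tau (2 * k + 1)) ([:0, 1:] * S k)"
    by (simp only: distrib_left mult_smult_right)
  also have "\<dots> = even_part (Suc (Suc k)) + smult (tau (2 * k + 1) + tau (2 * k + 2)) (even_part (Suc k))
    + smult (tau (2 * k + 1) * tau (2 * k)) (even_part k)"
    by (simp only: X smult_add_right smult_smult smult_add_left) (simp add: algebra_simps)
  finally show ?thesis
    by (simp only: tau_odd_plus_even tau_even_times_odd)
qed

lemma monom_eq_sum_even_part:
  "(monom 1 n :: 'a::field_char_0 poly fract poly)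
    = (\<Sum>k\<le>n. smult (laurent_coeff t n k) (even_part k))"
proof (induction n)
  case 0
  show ?case by (simp add: laurent_coeff_def)
next
  case (Suc n)
  let ?q = "laurent_coeff (t :: 'a poly fract) n" and ?R = "even_part :: nat \<Rightarrow> 'a poly fract poly"
  \<comment> \<open>The extra terms in \<open>ext\<close> and \<open>shift\<close> carry
    coefficients of index beyond n, which are 0. They allow the bottom term to be split off while
    the remaining sum still runs up to n.\<close>
  have ext: "(\<Sum>k\<le>n. smult (?q k) (f k)) = (\<Sum>k\<le>Suc n. smult (?q k) (f k))" for f
    by (simp add: laurent_coeff_eq_0)
  have shift: "(\<Sum>k\<le>n. smult (?q (Suc k)) (f k)) = (\<Sum>k\<le>Suc n. smult (?q (Suc k)) (f k))" for f
    by (simp add: laurent_coeff_eq_0)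
  have "monom 1 (Suc n) = (\<Sum>k\<le>Suc n. smult (?q k) ([:0, 1:] * ?R k))"
    unfolding ext[symmetric] mult_smult_right[symmetric] sum_distrib_left[symmetric] Suc[symmetric]
    by (simp add: monom_Suc)
  also have "\<dots> = smult (?q 0) (?R 1 + smult (1 + t) (?R 0)) +
      (\<Sum>k\<le>n. smult (?q (Suc k)) (?R (Suc (Suc k)) + smult (1 + t) (?R (Suc k))
        + smult (if k = 0 then 2 * t else t) (?R k)))"
    by (subst sum.atMost_Suc_shift) (simp only: X_times_even_part_0 X_times_even_part_Suc)
  \<comment> \<open>The three groups are the contributions that raise the index, keep it and lower
    it. Each is next rewritten as a sum over \<open>?R (Suc k)\<close>, with any \<open>?R 0\<close>
    term apart.\<close>
  also have "\<dots> = (smult (?q 0) (?R 1) + (\<Sum>k\<le>n. smult (?q (Suc k)) (?R (Suc (Suc k)))))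
      + (smult (?q 0) (smult (1 + t) (?R 0)) + (\<Sum>k\<le>n. smult (?q (Suc k)) (smult (1 + t) (?R (Suc k)))))
      + (\<Sum>k\<le>n. smult (?q (Suc k)) (smult (if k = 0 then 2 * t else t) (?R k)))"
    by (simp only: smult_add_right sum.distrib ac_simps)
  also have "smult (?q 0) (?R 1) + (\<Sum>k\<le>n. smult (?q (Suc k)) (?R (Suc (Suc k))))
      = (\<Sum>k\<le>n. smult (?q k) (?R (Suc k)))"
    unfolding ext by (subst sum.atMost_Suc_shift) simp
  also have "smult (?q 0) (smult (1 + t) (?R 0)) + (\<Sum>k\<le>n. smult (?q (Suc k)) (smult (1 + t) (?R (Suc k))))
     = smult ((1 + t) * ?q 0) (?R 0) + (\<Sum>k\<le>n. smult ((1 + t) * ?q (Suc k)) (?R (Suc k)))"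
    by (simp add: mult.commute)
  also have "(\<Sum>k\<le>n. smult (?q (Suc k)) (smult (if k = 0 then 2 * t else t) (?R k)))
      = smult (2 * t * ?q 1) (?R 0) + (\<Sum>k\<le>n. smult (t * ?q (Suc (Suc k))) (?R (Suc k)))"
    unfolding shift by (subst sum.atMost_Suc_shift) (simp add: mult.commute)
  also have "(\<Sum>k\<le>n. smult (?q k) (?R (Suc k)))
      + (smult ((1 + t) * ?q 0) (?R 0) + (\<Sum>k\<le>n. smult ((1 + t) * ?q (Suc k)) (?R (Suc k))))
      + (smult (2 * t * ?q 1) (?R 0) + (\<Sum>k\<le>n. smult (t * ?q (Suc (Suc k))) (?R (Suc k))))
      = smult ((1 + t) * ?q 0 + 2 * t * ?q 1) (?R 0)
      + (\<Sum>k\<le>n. smult (?q k + (1 + t) * ?q (Suc k) + t * ?q (Suc (Suc k))) (?R (Suc k)))"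
    by (simp only: smult_add_left[of "_ * _"] smult_add_left[of "_ + _ * _"] smult_add_left[of "?q _"]
        sum.distrib ac_simps)
  also have "\<dots> = (\<Sum>k\<le>Suc n. smult (laurent_coeff t (Suc n) k) (?R k))"
    by (subst sum.atMost_Suc_shift) (simp only: laurent_coeff_Suc_0 laurent_coeff_Suc_Suc)
  finally show ?case .
qed

text \<open>Shifting the first half of \<open>E\<close> by one index pairs \<open>S (Suc k)\<close>
  with \<open>tau (2 * k + 1)\<close> times \<open>S k\<close> under the same coefficient, and the
  pair adds up to \<open>even_part (Suc k)\<close>.\<close>

lemma monom_eq_sum_S: "(\<Sum>k=0..n. smult (E n k) (S k)) = (monom 1 n :: 'a::field_char_0 poly fract poly)"
proof -
  let ?q = "laurent_coeff (t :: 'a poly fract) n"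
  have "(\<Sum>k=0..n. smult (E n k) (S k))
      = (\<Sum>k\<le>n. smult (?q k) (S k)) + (\<Sum>k\<le>n. smult (tau (2 * k + 1) * ?q (Suc k)) (S k))"
    by (simp only: E_eq_laurent_coeff atLeast0AtMost smult_add_left sum.distrib)
  also have "(\<Sum>k\<le>n. smult (?q k) (S k)) = (\<Sum>k\<le>Suc n. smult (?q k) (S k))"
    by (simp add: laurent_coeff_eq_0)
  also have "\<dots> = smult (?q 0) (S 0) + (\<Sum>k\<le>n. smult (?q (Suc k)) (S (Suc k)))"
    by (rule sum.atMost_Suc_shift)
  also have "smult (?q 0) (S 0) + (\<Sum>k\<le>n. smult (?q (Suc k)) (S (Suc k)))
      + (\<Sum>k\<le>n. smult (tau (2 * k + 1) * ?q (Suc k)) (S k))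
      = smult (?q 0) (even_part 0)
        + (\<Sum>k\<le>n. smult (?q (Suc k)) (S (Suc k) + smult (tau (2 * k + 1)) (S k)))"
    by (simp add: S_0 smult_add_right sum.distrib mult.commute add.assoc)
  also have "\<dots> = smult (?q 0) (even_part 0) + (\<Sum>k\<le>n. smult (?q (Suc k)) (even_part (Suc k)))"
    by (simp only: S_Suc diff_add_cancel)
  also have "\<dots> = (\<Sum>k\<le>Suc n. smult (?q k) (even_part k))"
    by (rule sum.atMost_Suc_shift[symmetric])
  also have "\<dots> = monom 1 n"
    by (simp add: monom_eq_sum_even_part laurent_coeff_eq_0)
  finally show ?thesis .
qed

section \<open>Degrees, independence and the basis property\<close>

text \<open>The two families are defined through each other, so one induction treats both. Only x
  \<open>S k\<close> reaches degree k + 1, and it passes its leading coefficient on.\<close>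

lemma monic_even_part_S:
  "degree (even_part k :: 'a::field_char_0 poly fract poly) = k \<and>
   lead_coeff (even_part k :: 'a poly fract poly) = 1 \<and>
   degree (S k :: 'a poly fract poly) = k \<and> lead_coeff (S k :: 'a poly fract poly) = 1"
proof (induction k)
  case 0
  show ?case by (simp add: S_0)
next
  case (Suc k)
  have monicI: "degree p = m \<and> lead_coeff p = 1" if "coeff p m = 1" "\<And>i. i > m \<Longrightarrow> coeff p i = 0"
    for p :: "'a poly fract poly" and m
    using that by (metis degree_le le_antisym le_degree zero_neq_one)
  have R0: "coeff (even_part k :: 'a poly fract poly) i = 0" if "i > k" for i
    using Suc that by (intro coeff_eq_0) simp
  have S0: "coeff (S k :: 'a poly fract poly) i = 0" if "i > k" for i
    using Suc that by (intro coeff_eq_0) simp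
  have R: "degree (even_part (Suc k) :: 'a poly fract poly) = Suc k \<and>
      lead_coeff (even_part (Suc k) :: 'a poly fract poly) = 1"
    using Suc by (intro monicI) (auto simp: coeff_pCons R0 S0 split: nat.split)
  then have "degree (S (Suc k) :: 'a poly fract poly) = Suc k \<and>
      lead_coeff (S (Suc k) :: 'a poly fract poly) = 1"
    using Suc by (intro monicI) (auto simp: S_Suc S0 coeff_eq_0 simp del: even_part.simps)
  with R show ?case by blast
qed

lemma degree_sequence_independent:
  fixes B :: "nat \<Rightarrow> 'b::field poly"
  assumes deg: "\<And>k. degree (B k) = k" and nz: "\<And>k. B k \<noteq> 0"
    and "finite A" and sum0: "(\<Sum>k\<in>A. smult (c k) (B k)) = 0" and "i \<in> A"
  shows "c i = 0"
proof (rule ccontr)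
  assume "c i \<noteq> 0"
  define m where "m = Max {k \<in> A. c k \<noteq> 0}"
  have m: "m \<in> A" "c m \<noteq> 0"
    using Max_in[of "{k \<in> A. c k \<noteq> 0}"] \<open>finite A\<close> \<open>i \<in> A\<close> \<open>c i \<noteq> 0\<close> by (auto simp: m_def)
  have small: "k < m" if "k \<in> A" "c k \<noteq> 0" "k \<noteq> m" for k
    using Max_ge[of "{k \<in> A. c k \<noteq> 0}" k] \<open>finite A\<close> that by (simp add: m_def order.strict_iff_order)
  have "0 = coeff (\<Sum>k\<in>A. smult (c k) (B k)) m"
    by (simp add: sum0)
  \<comment> \<open>Compare coefficients at the largest index m with nonzero \<open>c m\<close>:
    terms below m have too small a degree, and those above have coefficient 0.\<close>
  also have "\<dots> = (\<Sum>k\<in>A. if k = m then c m * coeff (B m) m else 0)"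
    unfolding coeff_sum coeff_smult
    by (intro sum.cong) (auto simp: coeff_eq_0 deg dest: small)
  also have "\<dots> = c m * lead_coeff (B m)"
    using \<open>finite A\<close> m by (simp add: deg)
  finally show False
    using m nz[of m] by simp
qed

lemma is_basis_sequenceI:
  fixes B :: "nat \<Rightarrow> 'b::field poly"
  assumes deg: "\<And>k. degree (B k) = k" and nz: "\<And>k. B k \<noteq> 0"
    and monom: "\<And>n. monom 1 n = (\<Sum>k=0..n. smult (c n k) (B k))"
  shows "is_basis_sequence B"
proof -
  interpret module "smult :: 'b \<Rightarrow> 'b poly \<Rightarrow> 'b poly"
    by unfold_locales (simp_all add: smult_add_right smult_add_left)
  have inj: "inj B"
    by (metis deg injI)
  have "u v = 0" if T: "finite T" "T \<subseteq> range B" and sum0: "(\<Sum>v\<in>T. smult (u v) v) = 0" and "v \<in> T" for T u v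
  proof -
    obtain A where A: "T = B ` A" "finite A"
      using finite_subset_image[OF T] by blast
    have "(\<Sum>k\<in>A. smult (u (B k)) (B k)) = 0"
      using sum0 unfolding A by (subst (asm) sum.reindex) (auto intro: inj_on_subset[OF inj])
    then show ?thesis
      using degree_sequence_independent[where c = "\<lambda>k. u (B k)" and B = B, OF deg nz A(2)] \<open>v \<in> T\<close> A(1)
      by auto
  qed
  then have "independent (range B)"
    unfolding dependent_explicit by blast
  moreover have "p \<in> span (range B)" for p
  proof -
    have "monom 1 n \<in> span (range B)" for n
      unfolding monom by (intro span_sum span_scale span_base) simp
    then have "(\<Sum>i\<le>degree p. smult (coeff p i) (monom 1 i)) \<in> span (range B)"
      by (intro span_sum span_scale)
    then show ?thesis
      by (simp add: smult_monom poly_as_sum_of_monoms)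
  qed
  ultimately show ?thesis
    unfolding is_basis_sequence_def using inj by auto
qed

theorem theorem4:
  fixes n :: nat
  shows "(\<Sum>k=0..n. smult (E n k) (S k)) = (monom 1 n :: 'a::field_char_0 poly fract poly)
    \<and> degree (S n :: 'a poly fract poly) = n
    \<and> is_basis_sequence (S :: nat \<Rightarrow> 'a poly fract poly)
    \<and> (\<forall>c :: nat \<Rightarrow> 'a poly fract.
         finite {k. c k \<noteq> 0} \<and> (\<Sum>k | c k \<noteq> 0. smult (c k) (S k)) = monom 1 n
           \<longrightarrow> c = E n)"
proof -
  have deg: "degree (S k :: 'a poly fract poly) = k" for k
    using monic_even_part_S by blast
  have nz: "S k \<noteq> (0 :: 'a poly fract poly)" for k
    using monic_even_part_S[of k, where 'a = 'a] by auto
  have "c = E n" if fin: "finite {k. c k \<noteq> 0}"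
    and sum: "(\<Sum>k | c k \<noteq> 0. smult (c k) (S k)) = monom 1 n" for c :: "nat \<Rightarrow> 'a poly fract"
  proof
    fix i
    \<comment> \<open>A common finite index set for both expansions: it contains the supports of
      \<open>c\<close> and \<open>E n\<close>, as well as i, which may lie outside both.\<close>
    define A where "A = insert i ({k. c k \<noteq> 0} \<union> {0..n})"
    have A: "finite A" "i \<in> A"
      using fin by (auto simp: A_def)
    have "(\<Sum>k\<in>A. smult (c k) (S k)) = monom 1 n"
      unfolding sum[symmetric] using A(1) by (intro sum.mono_neutral_right) (auto simp: A_def)
    moreover have "(\<Sum>k\<in>A. smult (E n k) (S k)) = (monom 1 n :: 'a poly fract poly)"
      unfolding monom_eq_sum_S[symmetric] using A(1)
      by (intro sum.mono_neutral_right) (auto simp: A_def E_def)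
    ultimately have "(\<Sum>k\<in>A. smult (c k - E n k) (S k)) = 0"
      by (simp only: smult_diff_left sum_subtractf diff_self)
    then have "c i - E n i = 0"
      using degree_sequence_independent[where c = "\<lambda>k. c k - E n k", OF deg nz A(1) _ A(2)] by simp
    then show "c i = E n i" by simp
  qed
  moreover have "is_basis_sequence (S :: nat \<Rightarrow> 'a poly fract poly)"
    using is_basis_sequenceI[OF deg nz monom_eq_sum_S[symmetric]] .
  ultimately show ?thesis
    using deg monom_eq_sum_S by blast
qed

end
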